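(* Let $n$ be a positive integer, let $k$ be a nonnegative integer, and let $cw(n,k,[2])$ denote the number of weak compositions of $n$ in which exactly $k$ parts are equal to zero and each nonzero part is equal to $1$ or $2$. Then $$cw(n,k,[2])=\sum_{i=0}^{\lfloor\frac{n}{2}\rfloor}\binom{n+k-i}{i}\binom{n+k-2i}{k}.$$
   Context: A weak composition of $n$ is an ordered sequence of nonnegative integers (parts) whose sum is $n$; parts equal to $0$ are allowed. *)

theory Defs
  imports Complex_Main
begin

definition weak_composition :: "nat \<Rightarrow> nat list \<Rightarrow> bool" where
  "weak_composition n xs \<longleftrightarrow> sum_list xs = n"

definition weak_compositions_restricted :: "nat \<Rightarrow> nat \<Rightarrow> nat set \<Rightarrow> nat list set" where
  "weak_compositions_restricted n k A =
     {xs. weak_composition n xs \<and> count_list xs 0 = k \<and> (\<forall>x\<in>set xs. x \<noteq> 0 \<longrightarrow> x \<in> A)}"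

(* The bracket [m] of the usual notation cw(n, k, [m]) is the set {1..m}. *)
definition cw :: "nat \<Rightarrow> nat \<Rightarrow> nat set \<Rightarrow> nat" where
  "cw n k A = card (weak_compositions_restricted n k A)"

lemma length_le_sum_list_plus_zeros:
  fixes xs :: "nat list"
  shows "length xs \<le> sum_list xs + count_list xs 0"
  by (induction xs) auto

(* Hence card in the definition of cw is never the junk value of an infinite set. *)
lemma finite_weak_compositions_restricted:
  "finite (weak_compositions_restricted n k A)"
proof (rule finite_subset)
  show "weak_compositions_restricted n k A \<subseteq> {xs. set xs \<subseteq> {..n} \<and> length xs \<le> n + k}"
    using length_le_sum_list_plus_zeros
    by (auto simp: weak_compositions_restricted_def weak_composition_def member_le_sum_list)
  show "finite {xs. set xs \<subseteq> {..n} \<and> length xs \<le> n + k}"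
    by (rule finite_lists_length_le) simp
qed

end

theory Submission
  imports Defs "HOL-Combinatorics.Multiset_Permutations"
begin

text \<open>Sort the compositions by the number \<open>i\<close> of parts equal to \<open>2\<close>. Such a composition has \<open>k\<close>
  zeros and \<open>n - 2 * i\<close> ones, so it is an arrangement of a fixed multiset of \<open>n + k - i\<close> parts: choose
  the positions of the twos, then those of the zeros among the remaining ones.\<close>

definition parts_mset :: "nat \<Rightarrow> nat \<Rightarrow> nat \<Rightarrow> nat multiset" where
  "parts_mset a b c = replicate_mset a 0 + replicate_mset b 1 + replicate_mset c 2"

lemma count_parts_mset:
  "count (parts_mset a b c) x = (if x = 0 then a else if x = 1 then b else if x = 2 then c else 0)"
  by (simp add: parts_mset_def)

text \<open>A multinomial coefficient split into two binomials. Both sides are compared after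
  multiplication by \<open>fact a * fact b * fact c\<close>, which avoids division on the naturals;
  these positive factors cancel at the end.\<close>

lemma card_permutations_parts_mset:
  "card (permutations_of_multiset (parts_mset a b c)) = ((a + b + c) choose c) * ((a + b) choose a)"
proof -
  let ?M = "parts_mset a b c"
  \<comment> \<open>When some multiplicity is zero, \<open>set_mset ?M\<close> is smaller than
    \<open>{0,1,2}\<close>; each added value contributes \<open>fact 0 = 1\<close>.\<close>
  have "(\<Prod>x\<in>set_mset ?M. fact (count ?M x)) = (\<Prod>x\<in>{0,1,2}. fact (count ?M x) :: nat)"
    by (rule prod.mono_neutral_left)
      (auto simp: parts_mset_def not_in_iff split: if_splits)
  also have "\<dots> = fact a * fact b * fact c"
    by (simp add: count_parts_mset)
  finally have "fact a * fact b * fact c * card (permutations_of_multiset ?M) = fact (a + b + c)"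
    using card_permutations_of_multiset_aux[of ?M]
    by (simp add: parts_mset_def mult.commute)
  also have "\<dots> = fact c * (fact (a + b) * ((a + b + c) choose c))"
    using binomial_fact_lemma[of c "a + b + c"] by (simp add: mult.assoc)
  also have "fact (a + b) = fact a * fact b * ((a + b) choose a)"
    using binomial_fact_lemma[of a "a + b"] by simp
  finally show ?thesis
    by (simp add: ac_simps)
qed

lemma sum_list_eq_of_mset_eq_parts_mset:
  assumes "mset xs = parts_mset a b c"
  shows "sum_list xs = b + 2 * c"
  using assms by (simp flip: sum_mset_sum_list add: parts_mset_def)

lemma weak_compositions_restricted_2_eq:
  "weak_compositions_restricted n k {1..2} =
     (\<Union>i\<in>{0..n div 2}. permutations_of_multiset (parts_mset k (n - 2 * i) i))"
proof (intro equalityI subsetI)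
  fix xs assume "xs \<in> weak_compositions_restricted n k {1..2}"
  then have sum: "sum_list xs = n" and zeros: "count_list xs 0 = k"
    and parts: "\<forall>x\<in>set xs. x = 0 \<or> x = 1 \<or> x = 2"
    by (auto simp: weak_compositions_restricted_def weak_composition_def)
  have eq: "mset xs = parts_mset k (count_list xs 1) (count_list xs 2)"
    using zeros parts by (intro multiset_eqI) (auto simp: count_parts_mset count_mset count_list_0_iff)
  \<comment> \<open>The sum fixes the number of ones as \<open>n - 2 * i\<close>, where
    \<open>i\<close> is the number of twos, and forces \<open>i \<le> n div 2\<close>.\<close>
  with sum have "n = count_list xs 1 + 2 * count_list xs 2"
    by (simp add: sum_list_eq_of_mset_eq_parts_mset)
  with eq show "xs \<in> (\<Union>i\<in>{0..n div 2}. permutations_of_multiset (parts_mset k (n - 2 * i) i))"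
    by (auto simp: permutations_of_multiset_def intro!: bexI[of _ "count_list xs 2"])
next
  fix xs assume "xs \<in> (\<Union>i\<in>{0..n div 2}. permutations_of_multiset (parts_mset k (n - 2 * i) i))"
  then obtain i where i: "i \<le> n div 2" and eq: "mset xs = parts_mset k (n - 2 * i) i"
    by (auto simp: permutations_of_multiset_def)
  \<comment> \<open>The bound on \<open>i\<close> keeps the subtraction in \<open>n - 2 * i\<close>
    from being truncated, so the parts really add up to \<open>n\<close>.\<close>
  have "sum_list xs = n"
    using sum_list_eq_of_mset_eq_parts_mset[OF eq] i by simp
  moreover have "count_list xs 0 = k"
    using eq by (simp add: count_parts_mset flip: count_mset)
  moreover have "set xs \<subseteq> {0, 1, 2}"
    unfolding set_mset_mset[symmetric] eq by (auto simp: parts_mset_def split: if_splits)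
  ultimately show "xs \<in> weak_compositions_restricted n k {1..2}"
    by (auto simp: weak_compositions_restricted_def weak_composition_def)
qed

theorem theorem11:
  fixes n k :: nat
  assumes "n \<ge> 1"
  shows "cw n k {1..2} = (\<Sum>i = 0..n div 2. ((n + k - i) choose i) * ((n + k - 2 * i) choose k))"
proof -
  \<comment> \<open>All arrangements of one multiset share its number of twos, so different values
    of \<open>i\<close> cannot yield a common list.\<close>
  have disjoint: "permutations_of_multiset (parts_mset k (n - 2 * i) i) \<inter>
      permutations_of_multiset (parts_mset k (n - 2 * j) j) = {}" if "i \<noteq> j" for i j
  proof -
    have "count (parts_mset k (n - 2 * i) i) 2 \<noteq> count (parts_mset k (n - 2 * j) j) 2"
      using that by (simp add: count_parts_mset)
    then show ?thesis
      by (auto simp: permutations_of_multiset_def)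
  qed
  have "cw n k {1..2} =
      (\<Sum>i = 0..n div 2. card (permutations_of_multiset (parts_mset k (n - 2 * i) i)))"
    unfolding cw_def weak_compositions_restricted_2_eq
    by (rule card_UN_disjoint) (auto simp: disjoint)
  also have "\<dots> = (\<Sum>i = 0..n div 2. ((n + k - i) choose i) * ((n + k - 2 * i) choose k))"
  proof (rule sum.cong)
    fix i assume "i \<in> {0..n div 2}"
    \<comment> \<open>Since \<open>2 * i \<le> n\<close>, these rearrangements are exact for natural
      subtraction.\<close>
    then have "k + (n - 2 * i) + i = n + k - i" "k + (n - 2 * i) = n + k - 2 * i"
      by auto
    then show "card (permutations_of_multiset (parts_mset k (n - 2 * i) i)) =
        ((n + k - i) choose i) * ((n + k - 2 * i) choose k)"
      by (simp add: card_permutations_parts_mset)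
  qed simp
  finally show ?thesis .
qed

end
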